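(* Let $M$ be an acyclic oriented matroid on a finite set $E$, and let $t(M)$ be the maximal $k$ such that there exists a transitive coloring of $M$ using exactly $k$ colors. Then $t(M)=\operatorname{rank}(M)$.
   Context: An oriented matroid is acyclic if it has no positive circuit (no signed circuit $X=(X^+,X^-)$ with $X^-=\varnothing$). A transitive coloring of an oriented matroid $M$ on a finite set $E$ is a function $\varepsilon$ from $E$ to a set of colors such that for every signed circuit $X=(X^+,X^-)$ of $M$, $\{\varepsilon(e): e\in X^+\}\cap\{\varepsilon(e): e\in X^-\}\neq\varnothing$. It uses exactly $k$ colors if $|\varepsilon(E)|=k$. (If $E=\varnothing$, then $t(M)=0$.) *)

theory Defs
  imports Main
begin

type_synonym 'a signed_set = "'a set \<times> 'a set"

abbreviation pos_part :: "'a signed_set \<Rightarrow> 'a set" where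
  "pos_part X \<equiv> fst X"

abbreviation neg_part :: "'a signed_set \<Rightarrow> 'a set" where
  "neg_part X \<equiv> snd X"

definition signed_support :: "'a signed_set \<Rightarrow> 'a set" where
  "signed_support X = pos_part X \<union> neg_part X"

definition opposite :: "'a signed_set \<Rightarrow> 'a signed_set" where
  "opposite X = (neg_part X, pos_part X)"

text \<open>The signed circuit axioms for an oriented matroid on a finite ground set.\<close>

locale oriented_matroid =
  fixes E :: "'a set" and \<C> :: "'a signed_set set"
  assumes finite_ground: "finite E"
    and circuit_subset: "X \<in> \<C> \<Longrightarrow> signed_support X \<subseteq> E"
    and circuit_disjoint: "X \<in> \<C> \<Longrightarrow> pos_part X \<inter> neg_part X = {}"
    and empty_not_circuit: "({}, {}) \<notin> \<C>"
    and circuit_symmetric: "X \<in> \<C> \<Longrightarrow> opposite X \<in> \<C>"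
    and circuit_incomparable:
      "\<lbrakk>X \<in> \<C>; Y \<in> \<C>; signed_support X \<subseteq> signed_support Y\<rbrakk> \<Longrightarrow> X = Y \<or> X = opposite Y"
    and circuit_elimination:
      "\<lbrakk>X \<in> \<C>; Y \<in> \<C>; X \<noteq> opposite Y; e \<in> pos_part X \<inter> neg_part Y\<rbrakk> \<Longrightarrow>
        \<exists>Z\<in>\<C>. pos_part Z \<subseteq> (pos_part X \<union> pos_part Y) - {e}
            \<and> neg_part Z \<subseteq> (neg_part X \<union> neg_part Y) - {e}"

definition acyclic_om :: "'a signed_set set \<Rightarrow> bool" where
  "acyclic_om \<C> \<longleftrightarrow> \<not> (\<exists>X\<in>\<C>. neg_part X = {})"

text \<open>The underlying matroid has the supports of the signed circuits as its circuits.\<close>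

definition indep_om :: "'a set \<Rightarrow> 'a signed_set set \<Rightarrow> 'a set \<Rightarrow> bool" where
  "indep_om E \<C> I \<longleftrightarrow> I \<subseteq> E \<and> \<not> (\<exists>X\<in>\<C>. signed_support X \<subseteq> I)"

definition rank_om :: "'a set \<Rightarrow> 'a signed_set set \<Rightarrow> nat" where
  "rank_om E \<C> = Max {card I | I. indep_om E \<C> I}"

text \<open>Circuits are contained in the ground set, so only the values of a coloring on the
  ground set matter.\<close>

definition transitive_coloring :: "'a signed_set set \<Rightarrow> ('a \<Rightarrow> 'c) \<Rightarrow> bool" where
  "transitive_coloring \<C> \<epsilon> \<longleftrightarrow> (\<forall>X\<in>\<C>. \<epsilon> ` pos_part X \<inter> \<epsilon> ` neg_part X \<noteq> {})"

text \<open>Taking natural numbers as colors is no restriction when the ground set is finite: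
  see \<open>transitive_coloring_nat\<close> below. The set is finite and, for an acyclic oriented matroid,
  nonempty (\<open>color_numbers_finite\<close>, \<open>color_numbers_nonempty\<close>), so its maximum is meaningful.\<close>

definition color_numbers :: "'a set \<Rightarrow> 'a signed_set set \<Rightarrow> nat set" where
  "color_numbers E \<C> = {k. \<exists>\<epsilon> :: 'a \<Rightarrow> nat. transitive_coloring \<C> \<epsilon> \<and> card (\<epsilon> ` E) = k}"

definition max_colors :: "'a set \<Rightarrow> 'a signed_set set \<Rightarrow> nat" where
  "max_colors E \<C> = Max (color_numbers E \<C>)"

lemma (in oriented_matroid) transitive_coloring_nat:
  fixes \<epsilon> :: "'a \<Rightarrow> 'c"
  assumes "transitive_coloring \<C> \<epsilon>"
  shows "card (\<epsilon> ` E) \<in> color_numbers E \<C>"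
proof -
  obtain g :: "'c \<Rightarrow> nat" where g: "inj_on g (\<epsilon> ` E)"
    using finite_imp_inj_to_nat_seg[OF finite_imageI[OF finite_ground]] by metis
  have "transitive_coloring \<C> (g \<circ> \<epsilon>)"
    unfolding transitive_coloring_def
  proof
    fix X assume "X \<in> \<C>"
    then obtain c where "c \<in> \<epsilon> ` pos_part X" "c \<in> \<epsilon> ` neg_part X"
      using assms unfolding transitive_coloring_def by blast
    then have "g c \<in> (g \<circ> \<epsilon>) ` pos_part X \<inter> (g \<circ> \<epsilon>) ` neg_part X"
      unfolding image_comp[symmetric] by (intro IntI imageI)
    then show "(g \<circ> \<epsilon>) ` pos_part X \<inter> (g \<circ> \<epsilon>) ` neg_part X \<noteq> {}"
      by (metis empty_iff)
  qed
  moreover have "card ((g \<circ> \<epsilon>) ` E) = card (\<epsilon> ` E)"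
    using card_image[OF g] by (simp only: image_comp)
  ultimately show ?thesis
    unfolding color_numbers_def by blast
qed

lemma (in oriented_matroid) color_numbers_finite: "finite (color_numbers E \<C>)"
proof (rule finite_subset)
  show "color_numbers E \<C> \<subseteq> {..card E}"
    using card_image_le[OF finite_ground] by (auto simp: color_numbers_def)
qed simp

lemma (in oriented_matroid) color_numbers_nonempty:
  assumes "acyclic_om \<C>"
  shows "color_numbers E \<C> \<noteq> {}"
proof -
  have "transitive_coloring \<C> (\<lambda>_. ())"
    unfolding transitive_coloring_def
  proof
    fix X assume X: "X \<in> \<C>"
    have "neg_part (opposite X) \<noteq> {}"
      using assms circuit_symmetric[OF X] unfolding acyclic_om_def by blast
    then obtain e where e: "e \<in> pos_part X"
      by (auto simp: opposite_def)
    have "neg_part X \<noteq> {}"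
      using assms X unfolding acyclic_om_def by blast
    then obtain f where f: "f \<in> neg_part X"
      by blast
    from e f have "() \<in> (\<lambda>_. ()) ` pos_part X \<inter> (\<lambda>_. ()) ` neg_part X"
      by blast
    then show "(\<lambda>_. ()) ` pos_part X \<inter> (\<lambda>_. ()) ` neg_part X \<noteq> {}"
      by (metis empty_iff)
  qed
  from transitive_coloring_nat[OF this] show ?thesis
    by (metis empty_iff)
qed

end

theory Submission
  imports Defs
begin

text \<open>A set with pairwise distinct colors contains no circuit, so \<open>t(M) \<le> rank(M)\<close>. Conversely,
  rank many colors are found by induction on the ground set. If \<open>e\<close> and \<open>f\<close> are parallel, delete
  \<open>f\<close> and give it the color of \<open>e\<close> afterwards. Otherwise there is an element \<open>e\<close> that is extreme,
  i.e. not the only negative element of any circuit (the Krein-Milman theorem); the contraction of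
  \<open>e\<close> is then acyclic again, its rank drops by at most one, and \<open>e\<close> gets a new color of its own.\<close>

text \<open>Incomparability is left out for the sake of contraction: the sets \<open>X - {e}\<close>, for \<open>X\<close> a circuit, do
  not satisfy it, whereas passing to the minimal ones among them would make weak elimination hard
  to establish.\<close>

locale acyclic_system =
  fixes \<V> :: "'a signed_set set"
  assumes disjoint: "X \<in> \<V> \<Longrightarrow> pos_part X \<inter> neg_part X = {}"
    and symmetric: "X \<in> \<V> \<Longrightarrow> opposite X \<in> \<V>"
    and neg_nonempty: "X \<in> \<V> \<Longrightarrow> neg_part X \<noteq> {}"
    and elimination:
      "\<lbrakk>X \<in> \<V>; Y \<in> \<V>; X \<noteq> opposite Y; e \<in> pos_part X \<inter> neg_part Y\<rbrakk> \<Longrightarrow>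
        \<exists>Z\<in>\<V>. pos_part Z \<subseteq> (pos_part X \<union> pos_part Y) - {e}
            \<and> neg_part Z \<subseteq> (neg_part X \<union> neg_part Y) - {e}"
begin

section \<open>Supports and their elimination\<close>

lemma pos_nonempty: "X \<in> \<V> \<Longrightarrow> pos_part X \<noteq> {}"
  using neg_nonempty[OF symmetric[of X]] by (simp add: opposite_def)

lemma not_loop:
  assumes "X \<in> \<V>"
  shows "\<not> signed_support X \<subseteq> {e}"
  using disjoint[OF assms] pos_nonempty[OF assms] neg_nonempty[OF assms]
  unfolding signed_support_def by blast

text \<open>Weak elimination of the underlying matroid: passing to opposites gives \<open>e\<close>
  the required signs without changing supports, and different supports exclude the forbidden pair of
  opposites.\<close>

lemma support_elimination:
  assumes X: "X \<in> \<V>" and Y: "Y \<in> \<V>" and ne: "signed_support X \<noteq> signed_support Y"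
    and e: "e \<in> signed_support X" "e \<in> signed_support Y"
  shows "\<exists>Z\<in>\<V>. signed_support Z \<subseteq> signed_support X \<union> signed_support Y - {e}"
proof -
  have supp: "signed_support (opposite W) = signed_support W" for W :: "'a signed_set"
    by (auto simp: signed_support_def opposite_def)
  have *: ?thesis if prems: "X' \<in> \<V>" "Y' \<in> \<V>" "signed_support X' = signed_support X"
    "signed_support Y' = signed_support Y" "e \<in> pos_part X'" "e \<in> neg_part Y'" for X' Y'
  proof -
    have "X' \<noteq> opposite Y'"
      using prems(3,4) ne supp by metis
    then obtain Z where "Z \<in> \<V>" "pos_part Z \<subseteq> (pos_part X' \<union> pos_part Y') - {e}"
      "neg_part Z \<subseteq> (neg_part X' \<union> neg_part Y') - {e}"
      using elimination[of X' Y' e] prems by blast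
    then show ?thesis
      unfolding prems(3,4)[symmetric] by (intro bexI[of _ Z]) (auto simp: signed_support_def)
  qed
  have "\<exists>X'\<in>{X, opposite X}. e \<in> pos_part X'" "\<exists>Y'\<in>{Y, opposite Y}. e \<in> neg_part Y'"
    using e by (auto simp: signed_support_def opposite_def)
  then show ?thesis
    using * X Y symmetric supp by (metis insert_iff singletonD)
qed

section \<open>Extreme elements\<close>

text \<open>Geometrically, the negative part \<open>{e}\<close> places \<open>e\<close> in the
  convex hull of the positive part. If neither the new element \<open>e\<close> nor the old extreme
  element \<open>f\<close> is extreme in the larger set, eliminating \<open>e\<close> from the two
  witnesses leaves a member inside \<open>A\<close> with negative part \<open>{f}\<close>.\<close>

lemma exists_extreme:
  assumes simple: "\<And>e f. ({e}, {f}) \<notin> \<V>"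
    and "finite A" "A \<noteq> {}"
  shows "\<exists>e\<in>A. \<forall>X\<in>\<V>. signed_support X \<subseteq> A \<longrightarrow> neg_part X \<noteq> {e}"
  using assms(2,3)
proof (induction rule: finite_ne_induct)
  case (singleton e)
  then show ?case using not_loop by blast
next
  case (insert e A)
  then obtain f where f: "f \<in> A"
    and f_extreme: "\<And>X. X \<in> \<V> \<Longrightarrow> signed_support X \<subseteq> A \<Longrightarrow> neg_part X \<noteq> {f}"
    by blast
  show ?case
  proof (rule ccontr)
    assume no: "\<not> ?case"
    from no obtain Y where Y: "Y \<in> \<V>" "signed_support Y \<subseteq> insert e A" "neg_part Y = {e}"
      by blast
    from no f obtain X where X: "X \<in> \<V>" "signed_support X \<subseteq> insert e A" "neg_part X = {f}"
      by blast
    have "f \<noteq> e" using f insert.hyps by blast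
    moreover have "e \<in> signed_support X" using X f_extreme by blast
    ultimately have e: "e \<in> pos_part X" using X(3) by (auto simp: signed_support_def)
    \<comment> \<open>Otherwise \<open>X\<close> would be the excluded parallel pair
      \<open>({e}, {f})\<close>.\<close>
    have "X \<noteq> opposite Y"
      using simple[of e f] X(1,3) Y(3) by (metis fst_conv opposite_def prod.collapse)
    then obtain Z where Z: "Z \<in> \<V>" "pos_part Z \<subseteq> (pos_part X \<union> pos_part Y) - {e}"
      "neg_part Z \<subseteq> {f}"
      using elimination[of X Y e] X Y e by blast
    have "neg_part Z = {f}" using neg_nonempty[OF Z(1)] Z(3) by blast
    moreover have "signed_support Z \<subseteq> A"
      using Z X(2) Y(2) f unfolding signed_support_def by blast
    ultimately show False using f_extreme Z(1) by blast
  qed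
qed

end

section \<open>Deletion and contraction\<close>

definition deletion :: "'a signed_set set \<Rightarrow> 'a \<Rightarrow> 'a signed_set set" where
  "deletion \<V> f = {X \<in> \<V>. f \<notin> signed_support X}"

definition contraction :: "'a signed_set set \<Rightarrow> 'a \<Rightarrow> 'a signed_set set" where
  "contraction \<V> e = (\<lambda>X. (pos_part X - {e}, neg_part X - {e})) ` \<V>"

lemma (in acyclic_system) acyclic_system_deletion: "acyclic_system (deletion \<V> f)"
proof
  fix X Y e
  assume X: "X \<in> deletion \<V> f" and Y: "Y \<in> deletion \<V> f"
    and "X \<noteq> opposite Y" "e \<in> pos_part X \<inter> neg_part Y"
  then obtain Z where "Z \<in> \<V>" "pos_part Z \<subseteq> (pos_part X \<union> pos_part Y) - {e}"
    "neg_part Z \<subseteq> (neg_part X \<union> neg_part Y) - {e}"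
    using elimination[of X Y e] unfolding deletion_def by blast
  with X Y show "\<exists>Z\<in>deletion \<V> f. pos_part Z \<subseteq> (pos_part X \<union> pos_part Y) - {e}
            \<and> neg_part Z \<subseteq> (neg_part X \<union> neg_part Y) - {e}"
    by (intro bexI[of _ Z]) (auto simp: deletion_def signed_support_def)
next
  fix X assume "X \<in> deletion \<V> f"
  then show "opposite X \<in> deletion \<V> f"
    using symmetric[of X] by (auto simp: deletion_def signed_support_def opposite_def)
qed (use disjoint neg_nonempty in \<open>auto simp: deletion_def\<close>)

text \<open>Removing \<open>e\<close> could empty a negative part only if that part were
  \<open>{e}\<close>, which extremality excludes. Elimination carries over by eliminating
  \<open>g\<close> first and removing \<open>e\<close> afterwards.\<close>

lemma (in acyclic_system) acyclic_system_contraction: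
  assumes extreme: "\<And>X. X \<in> \<V> \<Longrightarrow> neg_part X \<noteq> {e}"
  shows "acyclic_system (contraction \<V> e)"
proof
  fix X' Y' g
  assume "X' \<in> contraction \<V> e" "Y' \<in> contraction \<V> e"
    and ne: "X' \<noteq> opposite Y'" and g: "g \<in> pos_part X' \<inter> neg_part Y'"
  then obtain X Y where X: "X \<in> \<V>" "X' = (pos_part X - {e}, neg_part X - {e})"
    and Y: "Y \<in> \<V>" "Y' = (pos_part Y - {e}, neg_part Y - {e})"
    unfolding contraction_def by blast
  have "X \<noteq> opposite Y" using ne X Y by (auto simp: opposite_def)
  then obtain Z where Z: "Z \<in> \<V>" "pos_part Z \<subseteq> (pos_part X \<union> pos_part Y) - {g}"
    "neg_part Z \<subseteq> (neg_part X \<union> neg_part Y) - {g}"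
    using elimination[of X Y g] X Y g by auto
  show "\<exists>Z\<in>contraction \<V> e. pos_part Z \<subseteq> (pos_part X' \<union> pos_part Y') - {g}
            \<and> neg_part Z \<subseteq> (neg_part X' \<union> neg_part Y') - {g}"
    by (rule bexI[of _ "(pos_part Z - {e}, neg_part Z - {e})"])
      (use X Y Z in \<open>auto simp: contraction_def\<close>)
next
  fix X assume "X \<in> contraction \<V> e"
  then show "opposite X \<in> contraction \<V> e"
    using symmetric unfolding contraction_def opposite_def by force
next
  fix X' assume "X' \<in> contraction \<V> e"
  then obtain X where "X \<in> \<V>" "X' = (pos_part X - {e}, neg_part X - {e})"
    unfolding contraction_def by blast
  then show "neg_part X' \<noteq> {}"
    using neg_nonempty[of X] extreme[of X] by auto
qed (use disjoint in \<open>fastforce simp: contraction_def\<close>)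

section \<open>Independent sets under deletion and contraction\<close>

text \<open>In an independent set \<open>e\<close> can take the place of \<open>f\<close>:
  eliminating \<open>e\<close> with the parallel pair turns a support inside the new set into one
  inside \<open>I\<close>.\<close>

lemma (in acyclic_system) indep_deletion_parallel:
  assumes P: "({e}, {f}) \<in> \<V>" and "e \<in> E" and I: "indep_om E \<V> I"
  shows "\<exists>J. indep_om (E - {f}) (deletion \<V> f) J \<and> card J = card I"
proof (cases "f \<in> I")
  case False
  then show ?thesis
    using I by (intro exI[of _ I]) (auto simp: indep_om_def deletion_def)
next
  case True
  have "e \<noteq> f" using disjoint[OF P] by auto
  have indep: "\<not> signed_support X \<subseteq> I" if "X \<in> \<V>" for X
    using I that unfolding indep_om_def by blast
  have "e \<notin> I" using indep[OF P] True by (auto simp: signed_support_def)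
  let ?J = "insert e (I - {f})"
  have "\<not> signed_support X \<subseteq> ?J" if X: "X \<in> \<V>" for X
  proof
    assume sub: "signed_support X \<subseteq> ?J"
    then have "f \<notin> signed_support X" using \<open>e \<noteq> f\<close> by blast
    moreover have "e \<in> signed_support X" using indep[OF X] sub by blast
    moreover have "f \<in> signed_support ({e}, {f})" "e \<in> signed_support ({e}, {f})"
      by (simp_all add: signed_support_def)
    ultimately obtain Z where "Z \<in> \<V>"
      "signed_support Z \<subseteq> signed_support X \<union> signed_support ({e}, {f}) - {e}"
      using support_elimination[OF X P, of e] by metis
    then show False
      using indep[of Z] sub True by (auto simp: signed_support_def)
  qed
  moreover have "?J \<subseteq> E - {f}"
    using I \<open>e \<in> E\<close> \<open>e \<noteq> f\<close> by (auto simp: indep_om_def)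
  \<comment> \<open>If \<open>I\<close> is infinite, both cardinalities are 0.\<close>
  moreover have "card ?J = card I"
    using True \<open>e \<notin> I\<close>
    by (cases "finite I") (simp_all add: card_Suc_Diff1 del: card_Diff_insert)
  ultimately show ?thesis
    unfolding indep_om_def deletion_def by blast
qed

lemma (in acyclic_system) indep_contraction:
  assumes I: "indep_om E \<V> I"
  shows "\<exists>J. indep_om (E - {e}) (contraction \<V> e) J \<and> card I \<le> Suc (card J)"
proof -
  have indep: "\<not> signed_support X \<subseteq> I" if "X \<in> \<V>" for X
    using I that unfolding indep_om_def by blast
  \<comment> \<open>Removing \<open>e\<close> from a support before comparing it with
    \<open>J\<close> amounts to adding \<open>e\<close> to \<open>J\<close>.\<close>
  have indep_iff: "indep_om (E - {e}) (contraction \<V> e) J \<longleftrightarrow>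
      J \<subseteq> E - {e} \<and> \<not> (\<exists>X\<in>\<V>. signed_support X \<subseteq> insert e J)" for J
    unfolding indep_om_def contraction_def signed_support_def by auto
  have card_le: "card I \<le> Suc (card (I - {g}))" for g
    by (cases "finite I \<and> g \<in> I") (auto simp: card_Suc_Diff1 simp del: card_Diff_insert)
  show ?thesis
  proof (cases "e \<in> I \<or> \<not> (\<exists>X\<in>\<V>. signed_support X \<subseteq> insert e I)")
    case True
    then have "\<not> (\<exists>X\<in>\<V>. signed_support X \<subseteq> insert e (I - {e}))"
      using indep by (auto simp: insert_absorb)
    then have "indep_om (E - {e}) (contraction \<V> e) (I - {e})"
      unfolding indep_iff using I by (auto simp: indep_om_def)
    then show ?thesis using card_le by blast
  next
    case False
    then obtain X where X: "X \<in> \<V>" "signed_support X \<subseteq> insert e I" and "e \<notin> I" by blast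
    \<comment> \<open>Dropping \<open>g\<close> destroys \<open>X\<close>. A member \<open>Y\<close>
      that still fits would also contain \<open>e\<close>, and eliminating \<open>e\<close> from
      \<open>X\<close> and \<open>Y\<close> would leave a support inside \<open>I\<close>.\<close>
    obtain g where g: "g \<in> signed_support X" "g \<noteq> e" using not_loop[OF X(1), of e] by blast
    have "\<not> signed_support Y \<subseteq> insert e (I - {g})" if Y: "Y \<in> \<V>" for Y
    proof
      assume sub: "signed_support Y \<subseteq> insert e (I - {g})"
      have "signed_support X \<noteq> signed_support Y" using sub g by blast
      moreover have "e \<in> signed_support X" "e \<in> signed_support Y"
        using indep[OF X(1)] indep[OF Y] X(2) sub by blast+
      ultimately obtain Z where "Z \<in> \<V>" "signed_support Z \<subseteq> signed_support X \<union> signed_support Y - {e}"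
        using support_elimination[OF X(1) Y] by blast
      then show False using indep[of Z] X(2) sub by blast
    qed
    then have "indep_om (E - {e}) (contraction \<V> e) (I - {g})"
      unfolding indep_iff using I \<open>e \<notin> I\<close> by (auto simp: indep_om_def)
    then show ?thesis using card_le by blast
  qed
qed

section \<open>Lifting colorings and the induction\<close>

text \<open>Eliminating \<open>f\<close> with the parallel pair replaces \<open>f\<close> by
  \<open>e\<close> in the part that contains it. As \<open>e\<close> has the color of
  \<open>f\<close>, this brings in no color that the part lacked.\<close>

lemma (in acyclic_system) transitive_coloring_parallel:
  assumes P: "({e}, {f}) \<in> \<V>" and col: "transitive_coloring (deletion \<V> f) \<epsilon>"
  shows "transitive_coloring \<V> (\<epsilon>(f := \<epsilon> e))"
proof -
  let ?\<delta> = "\<epsilon>(f := \<epsilon> e)"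
  have "e \<noteq> f" using disjoint[OF P] by auto
  have avoid: "?\<delta> ` pos_part X \<inter> ?\<delta> ` neg_part X \<noteq> {}" if "X \<in> \<V>" "f \<notin> signed_support X" for X
  proof -
    have "?\<delta> ` pos_part X = \<epsilon> ` pos_part X" "?\<delta> ` neg_part X = \<epsilon> ` neg_part X"
      using that(2) unfolding signed_support_def by (auto intro!: image_cong)
    then show ?thesis using that col unfolding transitive_coloring_def deletion_def by auto
  qed
  have pos: "?\<delta> ` pos_part X \<inter> ?\<delta> ` neg_part X \<noteq> {}" if X: "X \<in> \<V>" and f: "f \<in> pos_part X" for X
  proof (cases "X = opposite ({e}, {f})")
    case True
    then show ?thesis using \<open>e \<noteq> f\<close> by (simp add: opposite_def)
  next
    case False
    then obtain Z where Z: "Z \<in> \<V>" "pos_part Z \<subseteq> insert e (pos_part X) - {f}"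
      "neg_part Z \<subseteq> neg_part X - {f}"
      using elimination[OF X P, of f] f by auto
    have "?\<delta> ` pos_part Z \<inter> ?\<delta> ` neg_part Z \<noteq> {}"
      by (rule avoid) (use Z in \<open>auto simp: signed_support_def\<close>)
    moreover have "?\<delta> e \<in> ?\<delta> ` pos_part X"
      using f by (intro image_eqI[of _ _ f]) simp_all
    then have "?\<delta> ` insert e (pos_part X) = ?\<delta> ` pos_part X"
      by (simp only: image_insert insert_absorb)
    then have "?\<delta> ` pos_part Z \<subseteq> ?\<delta> ` pos_part X"
      using Z(2) by (metis Diff_subset image_mono order_trans)
    moreover have "?\<delta> ` neg_part Z \<subseteq> ?\<delta> ` neg_part X"
      using Z(3) by (intro image_mono) blast
    ultimately show ?thesis by (metis Int_mono subset_empty)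
  qed
  show ?thesis
    unfolding transitive_coloring_def
  proof
    fix X assume X: "X \<in> \<V>"
    consider "f \<in> pos_part X" | "f \<in> pos_part (opposite X)" | "f \<notin> signed_support X"
      by (auto simp: signed_support_def opposite_def)
    then show "?\<delta> ` pos_part X \<inter> ?\<delta> ` neg_part X \<noteq> {}"
    proof cases
      case 2
      then have "?\<delta> ` pos_part (opposite X) \<inter> ?\<delta> ` neg_part (opposite X) \<noteq> {}"
        by (rule pos[OF symmetric[OF X]])
      then show ?thesis by (simp add: opposite_def Int_commute)
    qed (use X pos avoid in blast)+
  qed
qed

text \<open>The two parts already share a color away from \<open>e\<close>, so the color given to
  \<open>e\<close> is arbitrary.\<close>

lemma transitive_coloring_contraction:
  assumes "transitive_coloring (contraction \<V> e) \<epsilon>"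
  shows "transitive_coloring \<V> (\<epsilon>(e := c))"
  unfolding transitive_coloring_def
proof
  fix X assume "X \<in> \<V>"
  then have "\<epsilon> ` (pos_part X - {e}) \<inter> \<epsilon> ` (neg_part X - {e}) \<noteq> {}"
    using assms unfolding transitive_coloring_def contraction_def by auto
  then show "(\<epsilon>(e := c)) ` pos_part X \<inter> (\<epsilon>(e := c)) ` neg_part X \<noteq> {}"
    by fastforce
qed

text \<open>Elements of the ground set serve as colors, so that a contracted element is its own new
  color.\<close>

lemma exists_transitive_coloring:
  assumes "finite E" "acyclic_system \<V>" "\<And>X. X \<in> \<V> \<Longrightarrow> signed_support X \<subseteq> E" "indep_om E \<V> I"
  shows "\<exists>\<epsilon>. transitive_coloring \<V> \<epsilon> \<and> \<epsilon> ` E \<subseteq> E \<and> card I \<le> card (\<epsilon> ` E)"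
  using assms
\<comment> \<open>The system and the independent set both change in each step. Bounding by an
  arbitrary \<open>I\<close> instead of the rank lets each step simply hand over a set
  \<open>J\<close>.\<close>
proof (induction "card E" arbitrary: E \<V> I rule: less_induct)
  case less
  interpret acyclic_system \<V> by fact
  have smaller: "card (E - {x}) < card E" if "x \<in> E" for x
    using less.prems(1) that by (rule card_Diff1_less)
  consider (empty) "E = {}" | (parallel) e f where "({e}, {f}) \<in> \<V>"
    | (simple) "E \<noteq> {}" "\<And>e f. ({e}, {f}) \<notin> \<V>"
    by blast
  then show ?case
  proof cases
    case empty
    have "\<V> = {}"
      using less.prems(3) not_loop unfolding empty by blast
    then show ?thesis
      using less.prems(4) unfolding empty by (auto simp: transitive_coloring_def indep_om_def)
  next
    case (parallel e f)
    have "e \<noteq> f" using disjoint[OF parallel] by auto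
    have "e \<in> E" "f \<in> E"
      using less.prems(3)[OF parallel] by (auto simp: signed_support_def)
    then obtain J where J: "indep_om (E - {f}) (deletion \<V> f) J" "card J = card I"
      using indep_deletion_parallel[OF parallel _ less.prems(4)] by blast
    have "\<exists>\<epsilon>. transitive_coloring (deletion \<V> f) \<epsilon> \<and> \<epsilon> ` (E - {f}) \<subseteq> E - {f}
        \<and> card J \<le> card (\<epsilon> ` (E - {f}))"
      by (rule less.hyps[OF smaller[OF \<open>f \<in> E\<close>] _ acyclic_system_deletion _ J(1)])
        (use less.prems(1,3) in \<open>auto simp: deletion_def\<close>)
    then obtain \<epsilon> where \<epsilon>: "transitive_coloring (deletion \<V> f) \<epsilon>" "\<epsilon> ` (E - {f}) \<subseteq> E - {f}"
      "card J \<le> card (\<epsilon> ` (E - {f}))"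
      by blast
    have "(\<epsilon>(f := \<epsilon> e)) ` E = \<epsilon> ` (E - {f})"
      using \<open>e \<in> E\<close> \<open>f \<in> E\<close> \<open>e \<noteq> f\<close> by auto
    with \<epsilon> J(2) show ?thesis
      by (intro exI[of _ "\<epsilon>(f := \<epsilon> e)"]) (auto intro: transitive_coloring_parallel[OF parallel])
  next
    case simple
    obtain e where "e \<in> E" and extreme: "\<And>X. X \<in> \<V> \<Longrightarrow> neg_part X \<noteq> {e}"
      using exists_extreme[OF simple(2) less.prems(1) simple(1)] less.prems(3) by blast
    obtain J where J: "indep_om (E - {e}) (contraction \<V> e) J" "card I \<le> Suc (card J)"
      using indep_contraction[OF less.prems(4)] by blast
    have "\<exists>\<epsilon>. transitive_coloring (contraction \<V> e) \<epsilon> \<and> \<epsilon> ` (E - {e}) \<subseteq> E - {e}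
        \<and> card J \<le> card (\<epsilon> ` (E - {e}))"
    proof (rule less.hyps[OF smaller[OF \<open>e \<in> E\<close>] _ acyclic_system_contraction[OF extreme] _ J(1)])
      fix X assume "X \<in> contraction \<V> e"
      then show "signed_support X \<subseteq> E - {e}"
        using less.prems(3) unfolding contraction_def signed_support_def by fastforce
    qed (use less.prems(1) in simp_all)
    then obtain \<epsilon> where \<epsilon>: "transitive_coloring (contraction \<V> e) \<epsilon>" "\<epsilon> ` (E - {e}) \<subseteq> E - {e}"
      "card J \<le> card (\<epsilon> ` (E - {e}))"
      by blast
    have img: "(\<epsilon>(e := e)) ` E = insert e (\<epsilon> ` (E - {e}))"
      using \<open>e \<in> E\<close> by auto
    \<comment> \<open>Colors from the induction hypothesis lie in \<open>E - {e}\<close>, so the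
      color \<open>e\<close> is new; it makes up for the element that may be lost from
      \<open>I\<close> to \<open>J\<close>.\<close>
    have "e \<notin> \<epsilon> ` (E - {e})" using \<epsilon>(2) by blast
    then have "card ((\<epsilon>(e := e)) ` E) = Suc (card (\<epsilon> ` (E - {e})))"
      unfolding img using less.prems(1) by simp
    moreover have "(\<epsilon>(e := e)) ` E \<subseteq> E"
      unfolding img using \<open>e \<in> E\<close> \<epsilon>(2) by blast
    ultimately show ?thesis
      using \<epsilon>(3) J(2) transitive_coloring_contraction[OF \<epsilon>(1), of e]
      by (intro exI[of _ "\<epsilon>(e := e)"]) auto
  qed
qed

section \<open>The two inequalities\<close>

lemma (in oriented_matroid) acyclic_system_circuits:
  assumes "acyclic_om \<C>"
  shows "acyclic_system \<C>"
  using assms circuit_disjoint circuit_symmetric circuit_elimination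
  by unfold_locales (auto simp: acyclic_om_def)

text \<open>On a circuit inside \<open>B\<close>, injectivity would turn a color common to both
  parts into an element common to both.\<close>

lemma (in oriented_matroid) indep_rainbow:
  assumes "transitive_coloring \<C> \<epsilon>" "B \<subseteq> E" "inj_on \<epsilon> B"
  shows "indep_om E \<C> B"
proof -
  have False if X: "X \<in> \<C>" "signed_support X \<subseteq> B" for X
  proof -
    obtain x y where xy: "x \<in> pos_part X" "y \<in> neg_part X" "\<epsilon> x = \<epsilon> y"
      using assms(1) X(1) unfolding transitive_coloring_def by blast
    then have "x = y"
      using inj_onD[OF assms(3)] X(2) by (auto simp: signed_support_def)
    then show False using xy circuit_disjoint[OF X(1)] by blast
  qed
  then show ?thesis using assms(2) unfolding indep_om_def by blast
qed

theorem theorem1p11: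
  fixes E :: "'a set" and \<C> :: "'a signed_set set"
  assumes "oriented_matroid E \<C>"
    and "acyclic_om \<C>"
  shows "max_colors E \<C> = rank_om E \<C>"
proof -
  interpret oriented_matroid E \<C> by fact
  interpret acyclic_system \<C> using assms(2) by (rule acyclic_system_circuits)
  let ?R = "{card I | I. indep_om E \<C> I}"
  \<comment> \<open>Finite and nonempty, \<open>?R\<close> attains its \<open>Max\<close>.\<close>
  have finR: "finite ?R"
  proof (rule finite_subset)
    show "?R \<subseteq> {..card E}"
      using card_mono[OF finite_ground] by (auto simp: indep_om_def)
  qed simp
  have "indep_om E \<C> {}"
    using not_loop unfolding indep_om_def by blast
  then have neR: "?R \<noteq> {}" by blast
  have "max_colors E \<C> \<in> color_numbers E \<C>"
    unfolding max_colors_def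
    by (rule Max_in[OF color_numbers_finite color_numbers_nonempty[OF assms(2)]])
  then obtain \<epsilon> :: "'a \<Rightarrow> nat" where \<epsilon>: "transitive_coloring \<C> \<epsilon>" "card (\<epsilon> ` E) = max_colors E \<C>"
    unfolding color_numbers_def by blast
  \<comment> \<open>\<open>B\<close> picks one element for each color.\<close>
  obtain B where B: "B \<subseteq> E" "inj_on \<epsilon> B" "\<epsilon> ` E = \<epsilon> ` B"
    by (metis subset_image_inj order_refl)
  then have card_B: "card B = max_colors E \<C>" using \<epsilon>(2) card_image by metis
  have "card B \<in> ?R" using indep_rainbow[OF \<epsilon>(1) B(1,2)] by blast
  then have "max_colors E \<C> \<le> rank_om E \<C>"
    unfolding rank_om_def card_B by (rule Max_ge[OF finR])
  moreover have "rank_om E \<C> \<le> max_colors E \<C>"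
  proof -
    have "rank_om E \<C> \<in> ?R"
      unfolding rank_om_def by (rule Max_in[OF finR neR])
    then obtain I where I: "indep_om E \<C> I" "card I = rank_om E \<C>" by force
    then obtain \<delta> :: "'a \<Rightarrow> 'a" where "transitive_coloring \<C> \<delta>" "card I \<le> card (\<delta> ` E)"
      using exists_transitive_coloring[OF finite_ground acyclic_system_axioms circuit_subset I(1)]
      by blast
    \<comment> \<open>The colors of \<open>\<delta>\<close> are elements of \<open>E\<close>;
      \<open>transitive_coloring_nat\<close> replaces them by natural numbers.\<close>
    then show ?thesis
      using Max_ge[OF color_numbers_finite transitive_coloring_nat] I(2)
      unfolding max_colors_def by fastforce
  qed
  ultimately show ?thesis by (rule antisym)
qed

end
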